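(* Let $b\geq 2$ be an integer, and let $m$ and $r$ be positive integers. Then the arithmetic progression $\mathcal{S}_{m,r}=\{mx+r : x\in\mathbb{N}\}$ contains infinitely many $b$-Niven numbers.
   Context: $\mathbb{N}$ denotes the set of positive integers. For an integer $b\geq 2$ and a positive integer $n$, $s_b(n)$ denotes the sum of the digits of $n$ in its base-$b$ representation; that is, if $n=\sum_{i=0}^{\lfloor\log_b n\rfloor}\nu_b(n,i)b^i$ with integers $0\leq \nu_b(n,i)\leq b-1$, then $s_b(n)=\sum_{i=0}^{\lfloor\log_b n\rfloor}\nu_b(n,i)$. A positive integer $n$ is called $b$-Niven if $s_b(n)\mid n$. *)

theory Defs
  imports Complex_Main
begin

definition digit :: "nat \<Rightarrow> nat \<Rightarrow> nat \<Rightarrow> nat" where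
  "digit b n i = (n div b ^ i) mod b"

definition digit_sum :: "nat \<Rightarrow> nat \<Rightarrow> nat" where
  "digit_sum b n = (\<Sum>i = 0..nat \<lfloor>log (real b) (real n)\<rfloor>. digit b n i)"

definition niven :: "nat \<Rightarrow> nat \<Rightarrow> bool" where
  "niven b n \<longleftrightarrow> n > 0 \<and> digit_sum b n dvd n"

text \<open>
  The closed form used for \<open>digit\<close> yields the digits of the base-b representation:
  they are bounded by \<open>b - 1\<close>, represent n over the stated index range, and are the
  only such coefficients.
\<close>

lemma digit_le:
  assumes "b \<ge> 2"
  shows "digit b n i \<le> b - 1"
proof -
  have "digit b n i < b" using assms by (simp add: digit_def)
  thus ?thesis by simp
qed

lemma digit_partial_sum:
  "(\<Sum>i<k. digit b n i * b ^ i) = n mod b ^ k"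
proof (induction k)
  case (Suc k)
  have "n mod (b ^ k * b) = b ^ k * (n div b ^ k mod b) + n mod b ^ k"
    by (rule mod_mult2_eq)
  thus ?case using Suc by (simp add: digit_def mult.commute)
qed simp

lemma less_power_Suc_log:
  fixes b n :: nat
  assumes "b \<ge> 2" "n > 0"
  shows "n < b ^ Suc (nat \<lfloor>log (real b) (real n)\<rfloor>)"
proof -
  let ?L = "nat \<lfloor>log (real b) (real n)\<rfloor>"
  have "log (real b) (real n) < real (Suc ?L)" by linarith
  hence "real n < real b powr real (Suc ?L)"
    using assms by (subst (asm) log_less_iff) auto
  also have "\<dots> = real (b ^ Suc ?L)"
    using assms by (subst powr_realpow) auto
  finally show ?thesis using of_nat_less_iff by blast
qed

lemma digit_expansion:
  assumes "b \<ge> 2" "n > 0"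
  shows "n = (\<Sum>i = 0..nat \<lfloor>log (real b) (real n)\<rfloor>. digit b n i * b ^ i)"
proof -
  have "(\<Sum>i = 0..nat \<lfloor>log (real b) (real n)\<rfloor>. digit b n i * b ^ i)
      = n mod b ^ Suc (nat \<lfloor>log (real b) (real n)\<rfloor>)"
    using digit_partial_sum[of b n "Suc (nat \<lfloor>log (real b) (real n)\<rfloor>)"]
    by (simp only: atLeast0AtMost lessThan_Suc_atMost)
  thus ?thesis using less_power_Suc_log[OF assms] by simp
qed

lemma digit_unique:
  fixes c :: "nat \<Rightarrow> nat"
  assumes "b \<ge> 2" "\<And>i. i \<le> k \<Longrightarrow> c i \<le> b - 1"
    and "n = (\<Sum>i = 0..k. c i * b ^ i)" and "i \<le> k"
  shows "c i = digit b n i"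
  using assms(2-)
proof (induction k arbitrary: c n i)
  case 0
  have "c 0 < b" using 0(1)[of 0] assms(1) by linarith
  thus ?case using 0 by (simp add: digit_def)
next
  case (Suc k)
  define n' where "n' = (\<Sum>j = 0..k. c (Suc j) * b ^ j)"
  have c0: "c 0 < b" using Suc.prems(1)[of 0] assms(1) by linarith
  have "n = c 0 + (\<Sum>j = 0..k. c (Suc j) * b ^ Suc j)"
    using Suc.prems(2) by (simp only: sum.atLeast0_atMost_Suc_shift comp_def) simp
  hence n: "n = c 0 + b * n'"
    by (simp add: n'_def sum_distrib_left mult_ac)
  show ?case
  proof (cases i)
    case 0
    thus ?thesis using n c0 by (simp add: digit_def)
  next
    case (Suc j)
    have "c (Suc j) = digit b n' j"
      by (rule Suc.IH[of "\<lambda>j. c (Suc j)"]) (use Suc.prems \<open>i = Suc j\<close> n'_def in auto)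
    also have "n' = n div b" using n c0 by simp
    finally show ?thesis using Suc by (simp add: digit_def div_mult2_eq)
  qed
qed

end

theory Submission
  imports Defs "HOL-Number_Theory.Cong"
begin

text \<open>
  Adding to \<open>n\<close> a power of \<open>b\<close> larger than \<open>n\<close> raises the digit sum by 1, and since the powers
  of \<open>b\<close> are eventually periodic modulo any \<open>P\<close>, the residue of that power may be prescribed
  among the periodic ones. We may assume \<open>r \<ge> 2\<close>. Put \<open>M = m r\<close>, choose \<open>e\<close> and \<open>d > 0\<close> such that
  \<open>M\<close> divides \<open>Q = b^e (b^d - 1)\<close>, and let \<open>t = 1 + b Q K\<close> with \<open>K\<close> large; the target digit sum
  is \<open>r t\<close>. Write \<open>r = s_b(r) + u (b - 1)\<close> and let \<open>E\<close> be a large exponent. Adding \<open>u b\<close> powers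
  congruent to \<open>b^E\<close> and \<open>u (M - 1)\<close> powers congruent to \<open>b^(E+1)\<close> modulo \<open>M t\<close> turns \<open>r\<close> into a number
  congruent to \<open>r\<close> modulo \<open>M\<close> with digit sum \<open>r + u M\<close>. The number \<open>L\<close> of powers that are still
  missing is a multiple of \<open>M\<close>. They are taken congruent to \<open>b^E\<close> or \<open>b^(E+d)\<close>, which agree modulo
  \<open>M\<close> but differ by a unit modulo \<open>t\<close>, so that a suitable number \<open>v < t \<le> L\<close> of the latter makes
  the result divisible by \<open>t\<close>. It is then divisible by the coprime numbers \<open>r\<close> and \<open>t\<close>.
\<close>

text \<open>Digits beyond the leading one vanish, so the logarithm in \<open>digit_sum\<close> can
  give way to any sufficient number \<open>k\<close> of digits.\<close>

lemma digit_sum_eq_sum_lessThan: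
  assumes "b \<ge> 2" "n > 0" "n < b ^ k"
  shows "digit_sum b n = (\<Sum>i<k. digit b n i)"
proof -
  define l where "l = Suc (nat \<lfloor>log (real b) (real n)\<rfloor>)"
  have extend: "(\<Sum>i<j. digit b n i) = (\<Sum>i<max k l. digit b n i)"
    if "n < b ^ j" "j \<le> max k l" for j
  proof (rule sum.mono_neutral_left)
    show "\<forall>i\<in>{..<max k l} - {..<j}. digit b n i = 0"
    proof
      fix i assume "i \<in> {..<max k l} - {..<j}"
      hence "b ^ j \<le> b ^ i" using assms(1) by (intro power_increasing) auto
      thus "digit b n i = 0" using that by (simp add: digit_def)
    qed
  qed (use that in auto)
  have "n < b ^ l" unfolding l_def by (rule less_power_Suc_log[OF assms(1,2)])
  hence "(\<Sum>i<l. digit b n i) = (\<Sum>i<k. digit b n i)"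
    using extend[of l] extend[of k] assms(3) by simp
  thus ?thesis
    by (simp only: digit_sum_def l_def atLeast0AtMost lessThan_Suc_atMost)
qed

lemma digit_sum_add_power:
  assumes "b \<ge> 2" "n > 0" "n < b ^ k"
  shows "digit_sum b (n + b ^ k) = digit_sum b n + 1"
proof -
  have low: "digit b (n + b ^ k) i = digit b n i" if i: "i < k" for i
  proof -
    obtain j where "k = Suc (i + j)" using i less_imp_Suc_add by blast
    hence "b ^ k = b * b ^ j * b ^ i" by (simp add: power_add)
    thus ?thesis using assms(1) by (simp add: digit_def)
  qed
  have top: "digit b (n + b ^ k) k = 1"
    using assms by (simp add: digit_def)
  have "2 * b ^ k \<le> b ^ Suc k" using assms(1) by simp
  hence "n + b ^ k < b ^ Suc k" using assms(3) by linarith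
  hence "digit_sum b (n + b ^ k) = (\<Sum>i<Suc k. digit b (n + b ^ k) i)"
    using assms by (intro digit_sum_eq_sum_lessThan) auto
  also have "\<dots> = (\<Sum>i<k. digit b n i) + 1" using low top by simp
  finally show ?thesis using digit_sum_eq_sum_lessThan[OF assms] by simp
qed

lemma power_eq_Suc_mult:
  fixes b :: nat
  assumes "b \<ge> 1"
  shows "\<exists>w. b ^ i = 1 + w * (b - 1)"
proof -
  have "[b = 1] (mod (b - 1))" using assms by (simp add: cong_altdef_nat)
  hence "[b ^ i = 1] (mod (b - 1))" using cong_pow by fastforce
  hence "b - 1 dvd b ^ i - 1" using assms by (simp add: cong_altdef_nat)
  then obtain w where "b ^ i - 1 = (b - 1) * w" by (rule dvdE)
  moreover have "b ^ i \<ge> 1" using assms by simp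
  ultimately have "b ^ i = 1 + w * (b - 1)" by (simp add: mult.commute)
  thus ?thesis by blast
qed

text \<open>Holds since every power of \<open>b\<close> is 1 modulo \<open>b - 1\<close>.\<close>

lemma eq_digit_sum_plus:
  assumes "b \<ge> 2" "n > 0"
  shows "\<exists>u. n = digit_sum b n + u * (b - 1)"
proof -
  obtain w where w: "\<And>i. b ^ i = 1 + w i * (b - 1)"
    using power_eq_Suc_mult[of b] assms(1) by (metis One_nat_def Suc_1 Suc_leD)
  let ?A = "{0..nat \<lfloor>log (real b) (real n)\<rfloor>}"
  have "n = (\<Sum>i\<in>?A. digit b n i * b ^ i)" by (rule digit_expansion[OF assms])
  also have "\<dots> = (\<Sum>i\<in>?A. digit b n i + digit b n i * w i * (b - 1))"
    by (rule sum.cong) (auto simp: w algebra_simps)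
  also have "\<dots> = digit_sum b n + (\<Sum>i\<in>?A. digit b n i * w i) * (b - 1)"
    by (simp add: sum.distrib digit_sum_def sum_distrib_right)
  finally show ?thesis by blast
qed

text \<open>Pigeonhole on the residues of the powers.\<close>

lemma power_eventually_periodic:
  fixes b P :: nat
  assumes "P > 0"
  obtains e d where "d > 0" "[b ^ (e + d) = b ^ e] (mod P)"
proof -
  have "range (\<lambda>i. b ^ i mod P) \<subseteq> {..<P}" using assms by auto
  hence "finite (range (\<lambda>i. b ^ i mod P))" by (rule finite_subset) simp
  hence "\<not> inj (\<lambda>i. b ^ i mod P)" using finite_imageD infinite_UNIV_nat by blast
  then obtain i j where ij: "i < j" "b ^ j mod P = b ^ i mod P"
    unfolding inj_on_def by (auto simp: linorder_neq_iff)
  have "[b ^ (i + (j - i)) = b ^ i] (mod P)" using ij by (simp add: cong_def)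
  thus thesis using that[of "j - i" i] ij(1) by simp
qed

text \<open>The exponents \<open>E + i * D\<close> give equal residues and are unbounded, so each of
  the \<open>k\<close> powers can be taken larger than the current number. The bound
  \<open>n + k\<close> later makes the final number exceed \<open>B\<close>.\<close>

lemma add_powers:
  assumes "b \<ge> 2" "n > 0" "D > 0" "[b ^ (E + D) = b ^ E] (mod P)"
  shows "\<exists>n'\<ge>n + k. [n' = n + k * b ^ E] (mod P) \<and> digit_sum b n' = digit_sum b n + k"
proof (induction k)
  case 0
  thus ?case by auto
next
  case (Suc k)
  then obtain n' where n': "n' \<ge> n + k" "[n' = n + k * b ^ E] (mod P)"
    "digit_sum b n' = digit_sum b n + k" by blast
  have per: "[b ^ (E + i * D) = b ^ E] (mod P)" for i
  proof (induction i)
    case (Suc i)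
    have "[b ^ (E + i * D) * b ^ D = b ^ E * b ^ D] (mod P)"
      using Suc by (rule cong_scalar_right)
    also have "[b ^ E * b ^ D = b ^ E] (mod P)"
      using assms(4) by (simp add: power_add)
    finally show ?case by (simp add: power_add mult_ac)
  qed simp
  have "n' < 2 ^ n'" by (rule less_exp)
  also have "\<dots> \<le> b ^ n'" using assms(1) by (rule power_mono) simp
  also have "n' \<le> E + n' * D" using assms(3) by (cases D) auto
  hence "b ^ n' \<le> b ^ (E + n' * D)" using assms(1) by (intro power_increasing) auto
  finally have less: "n' < b ^ (E + n' * D)" .
  have "n' + b ^ (E + n' * D) \<ge> n + Suc k" using n'(1) less by linarith
  moreover have "[n' + b ^ (E + n' * D) = (n + k * b ^ E) + b ^ E] (mod P)"
    using n'(2) per by (rule cong_add)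
  moreover have "digit_sum b (n' + b ^ (E + n' * D)) = digit_sum b n + Suc k"
    using digit_sum_add_power[OF assms(1) _ less] n' assms(2) by simp
  ultimately show ?case by (intro exI[of _ "n' + b ^ (E + n' * D)"]) (auto simp: algebra_simps)
qed

lemma ex_large_niven_cong:
  fixes b m r B :: nat
  assumes b: "b \<ge> 2" and m: "m > 0" and r: "r \<ge> 2"
  shows "\<exists>n>B. [n = r] (mod m) \<and> niven b n"
proof -
  \<comment> \<open>Congruence to \<open>r\<close> modulo \<open>M\<close> gives both the residue
    class modulo \<open>m\<close> and divisibility by \<open>r\<close>.\<close>
  define M where "M = m * r"
  have M: "M > 0" using m r by (simp add: M_def)
  obtain e d where d: "d > 0" "[b ^ (e + d) = b ^ e] (mod M)"
    using power_eventually_periodic[OF M] .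
  define c where "c = b ^ d - 1"
  have bd: "b ^ d = c + 1" using b by (simp add: c_def)
  have c: "c > 0" using b d(1) one_less_power[of b d] by (simp add: c_def)
  define Q where "Q = b ^ e * c"
  have Q: "Q > 0" using b c by (simp add: Q_def)
  have "b ^ (e + d) - b ^ e = Q" "b ^ e \<le> b ^ (e + d)"
    using b by (simp_all add: power_add bd Q_def)
  hence M_dvd_Q: "M dvd Q" using d(2) by (simp add: cong_altdef_nat)
  obtain u where u: "r = digit_sum b r + u * (b - 1)"
    using eq_digit_sum_plus[OF b] r by force
  \<comment> \<open>With \<open>r \<ge> 2\<close>, this size makes \<open>L\<close> at least
    \<open>N + 1 + B\<close>, so that \<open>L \<ge> t\<close> and \<open>L > B\<close>.\<close>
  define K where "K = u * M + 1 + B"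
  \<comment> \<open>The factor \<open>b * Q\<close> makes \<open>t\<close> coprime to
    \<open>b\<close>, \<open>c\<close> and \<open>r\<close>.\<close>
  define N where "N = b * Q * K"
  have NK: "N \<ge> K" using b Q mult_le_mono1[of 1 "b * Q" K] by (simp add: N_def)
  have MN: "M dvd N" using M_dvd_Q by (simp add: N_def)
  define t where "t = 1 + N"
  have t: "t > 0" by (simp add: t_def)
  define L where "L = r * N - u * M"
  have rN: "2 * N \<le> r * N" using r by (rule mult_le_mono1)
  have "r * t = r + r * N" by (simp add: t_def)
  hence rt: "r * t = r + u * M + L" using rN NK unfolding L_def K_def by linarith
  have L: "L \<ge> t" "L > B" using rN NK unfolding L_def K_def t_def by linarith+
  have M_dvd_L: "M dvd L" unfolding L_def using MN by (intro dvd_diff_nat) auto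
  have Mt: "M * t > 0" using M t by simp
  obtain e' D where D: "D > 0" "[b ^ (e' + D) = b ^ e'] (mod (M * t))"
    using power_eventually_periodic[OF Mt] .
  \<comment> \<open>The part \<open>e\<close> makes \<open>b ^ E * c\<close> divisible by
    \<open>Q\<close>, hence by \<open>M\<close>; the part \<open>e'\<close> gives periodicity modulo
    \<open>M * t\<close>.\<close>
  define E where "E = e + e'"
  have per: "[b ^ (E + j + D) = b ^ (E + j)] (mod (M * t))" for j
    using cong_scalar_left[OF D(2), of "b ^ (e + j)"] by (simp add: E_def power_add mult_ac)
  have QE: "b ^ E * c = Q * b ^ e'" by (simp add: E_def Q_def power_add mult_ac)
  have tN: "coprime t N" by (simp add: t_def coprime_commute)
  hence "coprime t b" "coprime t c" by (auto simp: N_def Q_def)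
  hence cop: "coprime (b ^ E * c) t" by (simp add: coprime_commute)

  define r' where "r' = r + (u * b) * b ^ E + (u * (M - 1)) * b ^ (E + 1)"
  have "r' = r + (u * b ^ (E + 1)) * M"
    using M by (cases M) (auto simp: r'_def algebra_simps)
  hence r'M: "[r' = r] (mod M)" by (simp add: cong_def)
  obtain y where y: "[(b ^ E * c) * y = 1] (mod t)"
    using cong_solve_coprime_nat[OF cop] by auto
  define a where "a = r' + L * b ^ E"
  \<comment> \<open>Solves \<open>a + (b ^ E * c) * v = 0\<close> modulo \<open>t\<close>:
    \<open>y\<close> inverts \<open>b ^ E * c\<close>, and \<open>t - 1\<close> stands for
    -1.\<close>
  define v where "v = (y * ((t - 1) * a)) mod t"
  have v: "v < t" using t by (simp add: v_def)
  have "[v = y * ((t - 1) * a)] (mod t)" by (simp add: v_def cong_def)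
  hence "[(b ^ E * c) * v = ((b ^ E * c) * y) * ((t - 1) * a)] (mod t)"
    unfolding mult.assoc[of _ y] by (rule cong_scalar_left)
  also have "[((b ^ E * c) * y) * ((t - 1) * a) = 1 * ((t - 1) * a)] (mod t)"
    using y by (rule cong_scalar_right)
  finally have "[a + (b ^ E * c) * v = a + (t - 1) * a] (mod t)"
    by (intro cong_add) auto
  also have "a + (t - 1) * a = t * a" using t by (cases t) auto
  finally have tdvd: "t dvd a + (b ^ E * c) * v"
    by (simp add: cong_dvd_iff)

  have step: "\<exists>n'\<ge>n + k. [n' = n + k * b ^ (E + j)] (mod (M * t)) \<and>
      digit_sum b n' = digit_sum b n + k" if "n \<ge> r" for n k j
    using add_powers[OF b _ D(1) per] that r by auto
  obtain n1 where n1: "n1 \<ge> r + u * b" "[n1 = r + (u * b) * b ^ (E + 0)] (mod (M * t))"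
    "digit_sum b n1 = digit_sum b r + u * b"
    using step[OF order_refl] by blast
  hence "n1 \<ge> r" by linarith
  from step[OF this] obtain n2 where n2: "n2 \<ge> n1 + u * (M - 1)"
    "[n2 = n1 + (u * (M - 1)) * b ^ (E + 1)] (mod (M * t))"
    "digit_sum b n2 = digit_sum b n1 + u * (M - 1)"
    by blast
  hence "n2 \<ge> r" using \<open>n1 \<ge> r\<close> by linarith
  from step[OF this] obtain n3 where n3: "n3 \<ge> n2 + (L - v)"
    "[n3 = n2 + (L - v) * b ^ (E + 0)] (mod (M * t))"
    "digit_sum b n3 = digit_sum b n2 + (L - v)"
    by blast
  hence "n3 \<ge> r" using \<open>n2 \<ge> r\<close> by linarith
  from step[OF this] obtain n where n: "n \<ge> n3 + v"
    "[n = n3 + v * b ^ (E + d)] (mod (M * t))"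
    "digit_sum b n = digit_sum b n3 + v"
    by blast

  have "[n2 = r'] (mod (M * t))"
    using cong_trans[OF n2(2) cong_add[OF n1(2) cong_refl]] by (simp add: r'_def)
  hence "[n3 = r' + (L - v) * b ^ E] (mod (M * t))"
    using cong_trans[OF n3(2) cong_add[OF _ cong_refl]] by simp
  hence "[n = r' + (L - v) * b ^ E + v * b ^ (E + d)] (mod (M * t))"
    using cong_trans[OF n(2) cong_add[OF _ cong_refl]] by blast
  \<comment> \<open>Each of the \<open>v\<close> exchanges of \<open>b ^ E\<close> for
    \<open>b ^ (E + d)\<close> adds \<open>b ^ E * c\<close>.\<close>
  also have "r' + (L - v) * b ^ E + v * b ^ (E + d) = a + (b ^ E * c) * v"
  proof -
    have "L * b ^ E = (L - v) * b ^ E + v * b ^ E"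
      using v L(1) by (simp flip: add_mult_distrib)
    thus ?thesis by (simp add: a_def power_add bd algebra_simps)
  qed
  finally have na: "[n = a + (b ^ E * c) * v] (mod (M * t))" .
  have "[n = a + (b ^ E * c) * v] (mod t)" using na by (rule cong_dvd_modulus_nat) simp
  hence tn: "t dvd n" using tdvd by (simp add: cong_dvd_iff)
  have "[n = r' + (L * b ^ E + (b ^ E * c) * v)] (mod M)"
    using cong_dvd_modulus_nat[OF na, of M] by (simp add: a_def add.assoc)
  also have "[r' + (L * b ^ E + (b ^ E * c) * v) = r + 0] (mod M)"
  proof (rule cong_add[OF r'M])
    have "M dvd L * b ^ E + (b ^ E * c) * v" using M_dvd_Q M_dvd_L by (simp add: QE)
    thus "[L * b ^ E + (b ^ E * c) * v = 0] (mod M)" by (simp add: cong_0_iff)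
  qed
  finally have nM: "[n = r] (mod M)" by simp
  have nm: "[n = r] (mod m)" using nM by (rule cong_dvd_modulus_nat) (simp add: M_def)
  have "[n = r] (mod r)" using nM by (rule cong_dvd_modulus_nat) (simp add: M_def)
  hence rn: "r dvd n" by (simp add: cong_dvd_iff)
  have "r dvd N" using MN by (auto simp: M_def dest: dvd_mult_right)
  hence "coprime r t"
    using tN by (meson coprime_commute coprime_divisors dvd_refl)
  hence rtn: "r * t dvd n" using rn tn by (rule divides_mult[rotated 2])
  have "digit_sum b n = digit_sum b r + u * b + u * (M - 1) + L"
    using n(3) n3(3) n2(3) n1(3) v L(1) by simp
  also have "u * b + u * (M - 1) = u * (b - 1) + u * M"
    using b M by (cases b; cases M) auto
  hence "digit_sum b r + u * b + u * (M - 1) + L = r * t"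
    using rt u by linarith
  finally have "digit_sum b n dvd n" using rtn by simp
  moreover have "n > B" using n(1) n3(1) L v by linarith
  ultimately show ?thesis using nm by (auto simp: niven_def)
qed

theorem theorem2p7:
  fixes b m r :: nat
  assumes "b \<ge> 2" and "m > 0" and "r > 0"
  shows "infinite {n \<in> {m * x + r | x. x > 0}. niven b n}"
  (is "infinite ?S")
proof
  assume "finite ?S"
  then obtain B where B: "\<And>n. n \<in> ?S \<Longrightarrow> n < B"
    by (auto simp: finite_nat_set_iff_bounded)
  \<comment> \<open>The representative \<open>r + m\<close> is at least 2, and
    \<open>n > r + m\<close> ensures a positive \<open>x\<close>.\<close>
  obtain n where n: "n > B + (r + m)" "[n = r + m] (mod m)" "niven b n"
    using ex_large_niven_cong[of b m "r + m" "B + (r + m)"] assms by auto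
  have "m dvd n - (r + m)" using n(1,2) by (simp add: cong_altdef_nat)
  then obtain q where "n - (r + m) = m * q" by (rule dvdE)
  hence "n = m * Suc q + r" using n(1) by simp
  hence "n \<in> ?S" using n(3) by blast
  thus False using B[of n] n(1) by simp
qed

end
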